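(* Let $\epsilon>0$ and set $\rho=\frac{\epsilon}{4D_f}$, $\mu=\frac{\epsilon}{4D_g}$, $\kappa=\frac{\epsilon}{2R^2}$. Let $(p_k)_{k\ge 0}$ be the sequence generated by the fast gradient method described in the context, applied to $\theta_{\rho,\mu,\kappa}$. Then for every integer $k\ge0$ with $$k\ge\frac{3}{\epsilon}\sqrt{\epsilon^2+8R^2\left(\|A\|^2D_f+D_g\right)}\;\ln\left(\frac{\sqrt[3]{\left(2\epsilon^2+16R^2(\|A\|^2D_f+D_g)\right)\left(\theta(0)-\theta(p^* )+\frac\epsilon2\right)}}{(2-\sqrt3)^{2/3}\,\epsilon}\right)$$ one has $$\|\nabla\theta_{\rho,\mu}(p_k)\|\le\frac{2\epsilon}{R}.$$ In particular, for fixed problem data, $k=O\left(\frac1\epsilon\ln\left(\frac1\epsilon\right)\right)$ iterations suffice (as $\epsilon\downarrow0$) to obtain $\|\nabla\theta_{\rho,\mu}(p_k)\|\le\frac{2\epsilon}{R}$.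
   Context: Let $f:\mathbb{R}^n\to\overline{\mathbb{R}}=\mathbb{R}\cup\{\pm\infty\}$ and $g:\mathbb{R}^m\to\overline{\mathbb{R}}$ be proper, convex and lower semicontinuous functions with bounded effective domains $\operatorname{dom} f=\{x: f(x)<+\infty\}$ and $\operatorname{dom} g$, and let $A:\mathbb{R}^n\to\mathbb{R}^m$ be linear with $A(\operatorname{dom} f)\cap\operatorname{dom} g\ne\emptyset$. Norms are Euclidean, $\|A\|$ is the operator norm, $A^*$ the adjoint, and $f^*(q)=\sup_x\{\langle q,x\rangle-f(x)\}$ the conjugate (similarly $g^*$); both conjugates are finite everywhere. The primal problem is $(P)$: $\inf_{x\in\mathbb{R}^n}\{f(x)+g(Ax)\}$. Its Fenchel dual is $(D)$: $\sup_{p\in\mathbb{R}^m}\{-f^*(A^*p)-g^*(-p)\}=-\inf_{p}\theta(p)$, where $\theta(p)=f^*(A^*p)+g^*(-p)$. It is assumed that $(D)$ has an optimal solution $p^*\in\mathbb{R}^m$ and that $R>0$ is a real number with $\|p^*\|\le R$. Put $D_f=\sup\{\frac{\|x\|^2}{2}:x\in\operatorname{dom} f\}$ and $D_g=\sup\{\frac{\|x\|^2}{2}:x\in\operatorname{dom} g\}$, assumed positive (they are finite by boundedness). For $\rho,\mu,\kappa>0$ define $f_\rho^*(A^*p)=\sup_{x\in\mathbb{R}^n}\{\langle A^*p,x\rangle-f(x)-\frac\rho2\|x\|^2\}$, $g_\mu^*(-p)=\sup_{x\in\mathbb{R}^m}\{\langle -p,x\rangle-g(x)-\frac\mu2\|x\|^2\}$,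 $\theta_{\rho,\mu}(p)=f_\rho^*(A^*p)+g_\mu^*(-p)$ and $\theta_{\rho,\mu,\kappa}(p)=\theta_{\rho,\mu}(p)+\frac\kappa2\|p\|^2$. With $x_{\rho,p}$ and $x_{\mu,p}$ denoting the unique maximizers in the definitions of $f_\rho^*(A^*p)$ and $g_\mu^*(-p)$ respectively, these functions are differentiable with $\nabla\theta_{\rho,\mu}(p)=Ax_{\rho,p}-x_{\mu,p}$ and $\nabla\theta_{\rho,\mu,\kappa}(p)=Ax_{\rho,p}-x_{\mu,p}+\kappa p$, and $\nabla\theta_{\rho,\mu,\kappa}$ is Lipschitz continuous with constant $L=\frac{\|A\|^2}{\rho}+\frac1\mu+\kappa$. Fast gradient method applied to $\theta_{\rho,\mu,\kappa}$: set $w_0=p_0=0\in\mathbb{R}^m$, and for $k\ge0$ $$p_{k+1}=w_k-\frac1L\nabla\theta_{\rho,\mu,\kappa}(w_k),\qquad w_{k+1}=p_{k+1}+\frac{\sqrt L-\sqrt\kappa}{\sqrt L+\sqrt\kappa}\,(p_{k+1}-p_k).$$ *)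

theory Defs
  imports "HOL-Analysis.Analysis" "HOL-Library.Landau_Symbols"
begin

section \<open>Extended-real-valued functions\<close>

definition edom :: "('a \<Rightarrow> ereal) \<Rightarrow> 'a set" where
  "edom f = {x. f x < \<infinity>}"

definition proper_fun :: "('a \<Rightarrow> ereal) \<Rightarrow> bool" where
  "proper_fun f \<longleftrightarrow> edom f \<noteq> {} \<and> (\<forall>x. - \<infinity> < f x)"

definition convex_fun :: "('a::real_vector \<Rightarrow> ereal) \<Rightarrow> bool" where
  "convex_fun f \<longleftrightarrow>
     (\<forall>x y. \<forall>t\<in>{0..1}. f (t *\<^sub>R x + (1 - t) *\<^sub>R y) \<le> ereal t * f x + ereal (1 - t) * f y)"

definition lsc_fun :: "('a::topological_space \<Rightarrow> ereal) \<Rightarrow> bool" where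
  "lsc_fun f \<longleftrightarrow> (\<forall>x. f x \<le> Liminf (at x) f)"

definition fenchel_conj :: "('a::real_inner \<Rightarrow> ereal) \<Rightarrow> 'a \<Rightarrow> ereal" where
  "fenchel_conj f q = (SUP x. ereal (q \<bullet> x) - f x)"

definition smooth_conj :: "real \<Rightarrow> ('a::real_inner \<Rightarrow> ereal) \<Rightarrow> 'a \<Rightarrow> ereal" where
  "smooth_conj \<rho> f q = (SUP x. ereal (q \<bullet> x) - f x - ereal (\<rho> / 2 * (norm x)\<^sup>2))"

text \<open>The supremum is taken in the reals, so it is meaningful for nonempty bounded domains only.\<close>

definition half_sq_radius :: "('a::real_normed_vector \<Rightarrow> ereal) \<Rightarrow> real" where
  "half_sq_radius f = (SUP x\<in>edom f. (norm x)\<^sup>2 / 2)"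

text \<open>Gradient of an extended-real-valued function that is finite near the point.\<close>

definition grad :: "('a::real_inner \<Rightarrow> ereal) \<Rightarrow> 'a \<Rightarrow> 'a" where
  "grad h p = (THE D. (\<forall>\<^sub>F q in nhds p. \<bar>h q\<bar> \<noteq> \<infinity>) \<and> (GDERIV (\<lambda>q. real_of_ereal (h q)) p :> D))"

section \<open>The Fenchel dual problem and its smoothings\<close>

definition dual_objective ::
  "('a::euclidean_space \<Rightarrow> ereal) \<Rightarrow> ('b::euclidean_space \<Rightarrow> ereal) \<Rightarrow> ('a \<Rightarrow> 'b) \<Rightarrow> 'b \<Rightarrow> ereal" where
  "dual_objective f g A p = - fenchel_conj f (adjoint A p) - fenchel_conj g (- p)"

definition dual_solution ::
  "('a::euclidean_space \<Rightarrow> ereal) \<Rightarrow> ('b::euclidean_space \<Rightarrow> ereal) \<Rightarrow> ('a \<Rightarrow> 'b) \<Rightarrow> 'b \<Rightarrow> bool" where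
  "dual_solution f g A p \<longleftrightarrow> dual_objective f g A p = (SUP q. dual_objective f g A q)"

definition theta ::
  "('a::euclidean_space \<Rightarrow> ereal) \<Rightarrow> ('b::euclidean_space \<Rightarrow> ereal) \<Rightarrow> ('a \<Rightarrow> 'b) \<Rightarrow> 'b \<Rightarrow> ereal" where
  "theta f g A p = fenchel_conj f (adjoint A p) + fenchel_conj g (- p)"

definition theta_smooth ::
  "('a::euclidean_space \<Rightarrow> ereal) \<Rightarrow> ('b::euclidean_space \<Rightarrow> ereal) \<Rightarrow> ('a \<Rightarrow> 'b) \<Rightarrow>
   real \<Rightarrow> real \<Rightarrow> 'b \<Rightarrow> ereal" where
  "theta_smooth f g A \<rho> \<mu> p = smooth_conj \<rho> f (adjoint A p) + smooth_conj \<mu> g (- p)"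

definition theta_double_smooth ::
  "('a::euclidean_space \<Rightarrow> ereal) \<Rightarrow> ('b::euclidean_space \<Rightarrow> ereal) \<Rightarrow> ('a \<Rightarrow> 'b) \<Rightarrow>
   real \<Rightarrow> real \<Rightarrow> real \<Rightarrow> 'b \<Rightarrow> ereal" where
  "theta_double_smooth f g A \<rho> \<mu> \<kappa> p = theta_smooth f g A \<rho> \<mu> p + ereal (\<kappa> / 2 * (norm p)\<^sup>2)"

definition lipschitz_const ::
  "('a::euclidean_space \<Rightarrow> 'b::euclidean_space) \<Rightarrow> real \<Rightarrow> real \<Rightarrow> real \<Rightarrow> real" where
  "lipschitz_const A \<rho> \<mu> \<kappa> = (onorm A)\<^sup>2 / \<rho> + 1 / \<mu> + \<kappa>"

section \<open>The fast gradient method\<close>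

text \<open>The pair of iterates \<open>(p\<^sub>k, w\<^sub>k)\<close>, for a gradient map \<open>G\<close>.\<close>

primrec fast_gradient ::
  "('b::real_normed_vector \<Rightarrow> 'b) \<Rightarrow> real \<Rightarrow> real \<Rightarrow> nat \<Rightarrow> 'b \<times> 'b" where
  "fast_gradient G L \<kappa> 0 = (0, 0)"
| "fast_gradient G L \<kappa> (Suc k) =
     (let (p, w) = fast_gradient G L \<kappa> k;
          p' = w - (1 / L) *\<^sub>R G w
      in (p', p' + ((sqrt L - sqrt \<kappa>) / (sqrt L + sqrt \<kappa>)) *\<^sub>R (p' - p)))"

definition dual_iterate ::
  "('a::euclidean_space \<Rightarrow> ereal) \<Rightarrow> ('b::euclidean_space \<Rightarrow> ereal) \<Rightarrow> ('a \<Rightarrow> 'b) \<Rightarrow>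
   real \<Rightarrow> real \<Rightarrow> real \<Rightarrow> nat \<Rightarrow> 'b" where
  "dual_iterate f g A \<rho> \<mu> \<kappa> k =
     fst (fast_gradient (grad (theta_double_smooth f g A \<rho> \<mu> \<kappa>)) (lipschitz_const A \<rho> \<mu> \<kappa>) \<kappa> k)"

end

theory Submission
  imports Defs
begin

text \<open>
  Strong convexity of the regularized functions yields
  \<open>\<kappa>/2 \<parallel>p' - p\<parallel>\<^sup>2 \<le> F p' - F p - \<langle>p' - p, \<nabla>F p\<rangle> \<le> L/2 \<parallel>p' - p\<parallel>\<^sup>2\<close> for the doubly smoothed
  objective \<open>F\<close>, which is all that the fast gradient method needs for
  \<open>F p\<^sub>k - F u \<le> 2 (F 0 - F u) exp (- k sqrt (\<kappa>/L))\<close>, where \<open>u\<close> minimizes \<open>F\<close>. Since \<open>\<theta>\<close> and its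
  smoothing differ by at most \<open>\<epsilon>/2\<close>, comparing \<open>F u\<close> with \<open>F p\<^sup>*\<close> gives \<open>\<parallel>u\<parallel> \<le> sqrt 3 R\<close>. The gradient
  of the singly smoothed objective is \<open>\<nabla>F p\<^sub>k - \<kappa> p\<^sub>k\<close>, of norm at most
  \<open>\<parallel>\<nabla>F p\<^sub>k\<parallel> + \<kappa> \<parallel>p\<^sub>k - u\<parallel> + \<kappa> \<parallel>u\<parallel>\<close>. The bound on \<open>k\<close> makes each of the first two terms at most
  \<open>(2 - sqrt 3) \<epsilon>/R\<close>, and the third is at most \<open>(sqrt 3)/2 \<sqdot> \<epsilon>/R\<close>.
\<close>

section \<open>Smoothed conjugates\<close>

text \<open>A real \<open>d\<close> strictly between \<open>c - u x\<close> and \<open>f x\<close>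
  decouples the two summands: near \<open>x\<close>, semicontinuity keeps \<open>f\<close> above
  \<open>d\<close> and continuity keeps \<open>u\<close> above \<open>c - d\<close>.\<close>

lemma open_lsc_add_superlevel:
  fixes f :: "'a::{t2_space,perfect_space} \<Rightarrow> ereal" and u :: "'a \<Rightarrow> real"
  assumes "lsc_fun f" "continuous_on UNIV u"
  shows "open {x. ereal c < f x + ereal (u x)}"
proof (subst open_subopen, intro ballI)
  fix x assume "x \<in> {x. ereal c < f x + ereal (u x)}"
  then have "ereal (c - u x) < f x"
    by (cases "f x") auto
  then obtain d where d: "ereal (c - u x) < ereal d" "ereal d < f x"
    using ereal_dense2 by blast
  have "\<forall>\<^sub>F y in at x. ereal d < f y"
    using assms(1) d(2) unfolding lsc_fun_def le_Liminf_iff by blast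
  \<comment> \<open>\<open>lsc_fun\<close> speaks of punctured neighbourhoods; the point
    \<open>x\<close> itself is covered by \<open>d < f x\<close>.\<close>
  then have "\<forall>\<^sub>F y in nhds x. ereal d < f y"
    using d(2) by (simp add: eventually_nhds_conv_at)
  moreover have "\<forall>\<^sub>F y in nhds x. c - d < u y"
  proof -
    have "(u \<longlongrightarrow> u x) (nhds x)"
      using assms(2) continuous_on_eq_continuous_at[OF open_UNIV, of u]
      by (simp add: isCont_def tendsto_nhds_iff)
    then show ?thesis
      using d(1) by (intro order_tendstoD) auto
  qed
  ultimately have "\<forall>\<^sub>F y in nhds x. ereal c < f y + ereal (u y)"
  proof eventually_elim
    case (elim y)
    then show ?case by (cases "f y") auto
  qed
  then show "\<exists>T. open T \<and> x \<in> T \<and> T \<subseteq> {x. ereal c < f x + ereal (u x)}"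
    unfolding eventually_nhds by auto
qed

lemma proper_fun_finite_on_edom:
  assumes "proper_fun f" "x \<in> edom f"
  shows "f x = ereal (real_of_ereal (f x))"
  using assms unfolding proper_fun_def edom_def by (cases "f x") auto

text \<open>Weierstrass on the compact closure of the domain. The domain need not be closed, but
  \<open>f\<close> is infinite on the added points, so a minimizer over the closure lies in the
  domain.\<close>

lemma lsc_bounded_domain_attains_inf:
  fixes f :: "'a::euclidean_space \<Rightarrow> ereal" and u :: "'a \<Rightarrow> real"
  assumes f: "proper_fun f" "lsc_fun f" "bounded (edom f)" and u: "continuous_on UNIV u"
  shows "\<exists>x\<in>edom f. \<forall>y\<in>edom f. real_of_ereal (f x) + u x \<le> real_of_ereal (f y) + u y"
proof -
  define K where "K = closure (edom f)"
  define \<psi> where "\<psi> = (\<lambda>x. f x + ereal (u x))"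
  define m where "m = (INF x\<in>K. \<psi> x)"
  have K: "compact K" "edom f \<subseteq> K"
    using f(3) closure_subset by (auto simp: K_def)
  have "\<exists>x\<in>K. \<psi> x \<le> m"
  proof (rule ccontr)
    assume "\<not> (\<exists>x\<in>K. \<psi> x \<le> m)"
    \<comment> \<open>If the infimum \<open>m\<close> is missed, open superlevel sets with levels
      above \<open>m\<close> cover \<open>K\<close>; the least level of a finite subcover is then a
      lower bound exceeding \<open>m\<close>.\<close>
    then have cover: "K \<subseteq> (\<Union>c\<in>{c. m < ereal c}. {x. ereal c < \<psi> x})"
      using ereal_dense2 by (fastforce simp: not_le)
    obtain C where C: "C \<subseteq> {c. m < ereal c}" "finite C" "K \<subseteq> (\<Union>c\<in>C. {x. ereal c < \<psi> x})"
      by (rule compactE_image[OF K(1) _ cover])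
        (use open_lsc_add_superlevel[OF f(2) u] in \<open>auto simp: \<psi>_def\<close>)
    have "C \<noteq> {}"
      using C(3) K(2) f(1) by (auto simp: proper_fun_def)
    then have "m < ereal (Min C)"
      using C(1,2) Min_in by blast
    moreover have "ereal (Min C) \<le> m"
      unfolding m_def
    proof (rule INF_greatest)
      fix x assume "x \<in> K"
      then obtain c where "c \<in> C" "ereal c < \<psi> x"
        using C(3) by blast
      then show "ereal (Min C) \<le> \<psi> x"
        using C(2) by (meson Min_le ereal_less_eq(3) less_imp_le order_trans)
    qed
    ultimately show False by simp
  qed
  then obtain x where "x \<in> K" "\<psi> x \<le> m" by blast
  then have min: "\<psi> x \<le> \<psi> y" if "y \<in> edom f" for y
    using that K(2) unfolding m_def by (meson INF_lower order_trans subsetD)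
  obtain y where y: "y \<in> edom f"
    using f(1) by (auto simp: proper_fun_def)
  then have "\<psi> x < \<infinity>"
    using min[OF y] by (auto simp: \<psi>_def edom_def)
  then have x: "x \<in> edom f"
    by (auto simp: \<psi>_def edom_def)
  have "real_of_ereal (f x) + u x \<le> real_of_ereal (f y) + u y" if "y \<in> edom f" for y
    using min[OF that] proper_fun_finite_on_edom[OF f(1) x] proper_fun_finite_on_edom[OF f(1) that]
    unfolding \<psi>_def by (metis ereal_less_eq(3) plus_ereal.simps(1))
  with x show ?thesis by blast
qed

text \<open>Maximizing means minimizing \<open>f\<close> plus a continuous function, and points
  outside the domain contribute minus infinity. The case \<open>\<rho> = 0\<close> serves the plain
  conjugate.\<close>

lemma smooth_conj_attained:
  fixes f :: "'a::euclidean_space \<Rightarrow> ereal"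
  assumes "proper_fun f" "lsc_fun f" "bounded (edom f)"
  shows "\<exists>x\<in>edom f.
    (\<forall>y\<in>edom f. q \<bullet> y - real_of_ereal (f y) - \<rho> / 2 * (norm y)\<^sup>2
        \<le> q \<bullet> x - real_of_ereal (f x) - \<rho> / 2 * (norm x)\<^sup>2) \<and>
    smooth_conj \<rho> f q = ereal (q \<bullet> x - real_of_ereal (f x) - \<rho> / 2 * (norm x)\<^sup>2)"
proof -
  have "continuous_on UNIV (\<lambda>x. \<rho> / 2 * (norm x)\<^sup>2 - q \<bullet> x)"
    by (intro continuous_intros)
  from lsc_bounded_domain_attains_inf[OF assms this]
  obtain x where x: "x \<in> edom f" and min:
    "\<forall>y\<in>edom f. real_of_ereal (f x) + (\<rho> / 2 * (norm x)\<^sup>2 - q \<bullet> x)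
        \<le> real_of_ereal (f y) + (\<rho> / 2 * (norm y)\<^sup>2 - q \<bullet> y)"
    by (rule bexE)
  have max: "q \<bullet> y - real_of_ereal (f y) - \<rho> / 2 * (norm y)\<^sup>2
        \<le> q \<bullet> x - real_of_ereal (f x) - \<rho> / 2 * (norm x)\<^sup>2" if "y \<in> edom f" for y
    using bspec[OF min that] by linarith
  have val: "ereal (q \<bullet> y) - f y - ereal (\<rho> / 2 * (norm y)\<^sup>2)
      = ereal (q \<bullet> y - real_of_ereal (f y) - \<rho> / 2 * (norm y)\<^sup>2)" if "y \<in> edom f" for y
    using proper_fun_finite_on_edom[OF assms(1) that] by (metis ereal_minus(1))
  have "smooth_conj \<rho> f q = ereal (q \<bullet> x - real_of_ereal (f x) - \<rho> / 2 * (norm x)\<^sup>2)"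
    unfolding smooth_conj_def
  proof (rule antisym)
    show "(SUP y. ereal (q \<bullet> y) - f y - ereal (\<rho> / 2 * (norm y)\<^sup>2))
        \<le> ereal (q \<bullet> x - real_of_ereal (f x) - \<rho> / 2 * (norm x)\<^sup>2)"
    proof (rule SUP_least)
      fix y
      show "ereal (q \<bullet> y) - f y - ereal (\<rho> / 2 * (norm y)\<^sup>2)
          \<le> ereal (q \<bullet> x - real_of_ereal (f x) - \<rho> / 2 * (norm x)\<^sup>2)"
      proof (cases "y \<in> edom f")
        case True
        show ?thesis unfolding val[OF True] using max[OF True] by (simp only: ereal_less_eq)
      next
        case False
        then show ?thesis by (simp add: edom_def)
      qed
    qed
    have "ereal (q \<bullet> x) - f x - ereal (\<rho> / 2 * (norm x)\<^sup>2)
        \<le> (SUP y. ereal (q \<bullet> y) - f y - ereal (\<rho> / 2 * (norm y)\<^sup>2))"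
      by (intro SUP_upper UNIV_I)
    then show "ereal (q \<bullet> x - real_of_ereal (f x) - \<rho> / 2 * (norm x)\<^sup>2)
        \<le> (SUP y. ereal (q \<bullet> y) - f y - ereal (\<rho> / 2 * (norm y)\<^sup>2))"
      unfolding val[OF x] .
  qed
  with x max show ?thesis by (intro bexI[of _ x] conjI ballI)
qed

lemma fenchel_conj_eq_smooth_conj: "fenchel_conj f = smooth_conj 0 f"
  unfolding fenchel_conj_def smooth_conj_def by (simp flip: zero_ereal_def)

lemma convex_fun_real:
  assumes "proper_fun f" "convex_fun f" "x \<in> edom f" "y \<in> edom f" "0 \<le> t" "t \<le> 1"
  shows "t *\<^sub>R x + (1 - t) *\<^sub>R y \<in> edom f"
    "real_of_ereal (f (t *\<^sub>R x + (1 - t) *\<^sub>R y)) \<le> t * real_of_ereal (f x) + (1 - t) * real_of_ereal (f y)"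
proof -
  let ?z = "t *\<^sub>R x + (1 - t) *\<^sub>R y"
  have "f ?z \<le> ereal t * f x + ereal (1 - t) * f y"
    using assms unfolding convex_fun_def by auto
  also have "\<dots> = ereal (t * real_of_ereal (f x) + (1 - t) * real_of_ereal (f y))"
    using proper_fun_finite_on_edom[OF assms(1,3)] proper_fun_finite_on_edom[OF assms(1,4)]
    by (metis plus_ereal.simps(1) times_ereal.simps(1))
  finally have le: "f ?z \<le> \<dots>" .
  then show z: "?z \<in> edom f"
    by (auto simp: edom_def)
  show "real_of_ereal (f ?z) \<le> t * real_of_ereal (f x) + (1 - t) * real_of_ereal (f y)"
    using le by (subst (asm) proper_fun_finite_on_edom[OF assms(1) z]) simp
qed

section \<open>Quadratic bounds and smoothing error\<close>

text \<open>Along a segment the penalty gains exactly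
  \<open>t * (1 - t) * (\<rho> / 2 * (norm (y - x))\<^sup>2)\<close> over linear interpolation,
  while convexity of \<open>f\<close> loses nothing. Optimality of \<open>x\<close>, division by
  \<open>t\<close> and \<open>t\<close> tending to 0 give the claim.\<close>

lemma smooth_conj_maximizer_quadratic_growth:
  fixes f :: "'a::real_inner \<Rightarrow> ereal"
  assumes f: "proper_fun f" "convex_fun f" and x: "x \<in> edom f" and y: "y \<in> edom f"
    and max: "\<And>z. z \<in> edom f \<Longrightarrow> q \<bullet> z - real_of_ereal (f z) - \<rho> / 2 * (norm z)\<^sup>2
        \<le> q \<bullet> x - real_of_ereal (f x) - \<rho> / 2 * (norm x)\<^sup>2"
  shows "q \<bullet> y - real_of_ereal (f y) - \<rho> / 2 * (norm y)\<^sup>2 + \<rho> / 2 * (norm (y - x))\<^sup>2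
        \<le> q \<bullet> x - real_of_ereal (f x) - \<rho> / 2 * (norm x)\<^sup>2" (is "?Vy + _ \<le> ?Vx")
proof -
  have *: "?Vy + (1 - t) * (\<rho> / 2 * (norm (y - x))\<^sup>2) \<le> ?Vx" if t: "0 < t" "t < 1" for t
  proof -
    \<comment> \<open>compare the maximizer with points close to it on the segment towards \<open>y\<close>\<close>
    let ?z = "t *\<^sub>R y + (1 - t) *\<^sub>R x"
    have N: "(norm ?z)\<^sup>2 = t * (norm y)\<^sup>2 + (1 - t) * (norm x)\<^sup>2 - t * (1 - t) * (norm (y - x))\<^sup>2"
      unfolding power2_norm_eq_inner by (simp add: inner_simps inner_commute algebra_simps)
    have I: "q \<bullet> ?z = t * (q \<bullet> y) + (1 - t) * (q \<bullet> x)"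
      by (simp add: inner_simps)
    have "t * ?Vy + (1 - t) * ?Vx + t * (1 - t) * (\<rho> / 2 * (norm (y - x))\<^sup>2)
        = q \<bullet> ?z - (t * real_of_ereal (f y) + (1 - t) * real_of_ereal (f x)) - \<rho> / 2 * (norm ?z)\<^sup>2"
      unfolding N I by (simp add: field_simps)
    also have "\<dots> \<le> ?Vx"
      using convex_fun_real[OF f y x, of t] max[of ?z] t by simp
    finally have "t * (?Vy + (1 - t) * (\<rho> / 2 * (norm (y - x))\<^sup>2)) \<le> t * ?Vx"
      by (simp add: field_simps)
    then show ?thesis using t by simp
  qed
  have "((\<lambda>t. ?Vy + (1 - t) * (\<rho> / 2 * (norm (y - x))\<^sup>2)) \<longlongrightarrow> ?Vy + (1 - 0) * (\<rho> / 2 * (norm (y - x))\<^sup>2)) (at_right 0)"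
    by (intro tendsto_intros)
  moreover have "\<forall>\<^sub>F t in at_right (0::real). ?Vy + (1 - t) * (\<rho> / 2 * (norm (y - x))\<^sup>2) \<le> ?Vx"
    unfolding eventually_at_right_field using * by (intro exI[of _ 1]) auto
  ultimately show ?thesis
    using tendsto_upperbound[of _ _ "at_right (0::real)"] by fastforce
qed

text \<open>\<open>X q\<close> is the maximizer, which acts as the gradient of \<open>h\<close>.
  Testing the problem for \<open>q'\<close> with \<open>X q\<close> gives the lower bound; quadratic
  growth of the problem for \<open>q\<close> at \<open>X q'\<close> gives the upper one.\<close>

lemma smooth_conj_sandwich:
  fixes f :: "'a::euclidean_space \<Rightarrow> ereal"
  assumes f: "proper_fun f" "convex_fun f" "lsc_fun f" "bounded (edom f)" and \<rho>: "0 < \<rho>"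
  obtains h X where "\<And>q. smooth_conj \<rho> f q = ereal (h q)"
    "\<And>q q'. 0 \<le> h q' - h q - (q' - q) \<bullet> X q"
    "\<And>q q'. h q' - h q - (q' - q) \<bullet> X q \<le> (norm (q' - q))\<^sup>2 / (2 * \<rho>)"
proof -
  let ?V = "\<lambda>q x. q \<bullet> x - real_of_ereal (f x) - \<rho> / 2 * (norm x)\<^sup>2"
  have "\<forall>q. \<exists>x. x \<in> edom f \<and> (\<forall>y\<in>edom f. ?V q y \<le> ?V q x) \<and> smooth_conj \<rho> f q = ereal (?V q x)"
    using smooth_conj_attained[OF f(1,3,4)] by blast
  then obtain X where X: "\<And>q. X q \<in> edom f" "\<And>q y. y \<in> edom f \<Longrightarrow> ?V q y \<le> ?V q (X q)"
    "\<And>q. smooth_conj \<rho> f q = ereal (?V q (X q))"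
    by metis
  have lower: "0 \<le> ?V q' (X q') - ?V q (X q) - (q' - q) \<bullet> X q" for q q'
    using X(2)[OF X(1), of q' q] by (simp add: inner_simps)
  have upper: "?V q' (X q') - ?V q (X q) - (q' - q) \<bullet> X q \<le> (norm (q' - q))\<^sup>2 / (2 * \<rho>)" for q q'
  proof -
    let ?d = "X q' - X q" and ?e = "q' - q"
    have "?V q (X q') + \<rho> / 2 * (norm ?d)\<^sup>2 \<le> ?V q (X q)"
      using smooth_conj_maximizer_quadratic_growth[OF f(1,2) X(1) X(1) X(2)] by blast
    then have "?V q' (X q') - ?V q (X q) - ?e \<bullet> X q \<le> ?e \<bullet> ?d - \<rho> / 2 * (norm ?d)\<^sup>2"
      by (simp add: inner_simps)
    also have "\<dots> \<le> (norm ?e)\<^sup>2 / (2 * \<rho>)"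
    proof -
      \<comment> \<open>Completing the square eliminates the unknown displacement \<open>?d\<close>
        of the maximizers.\<close>
      have "0 \<le> (norm (?e - \<rho> *\<^sub>R ?d))\<^sup>2" by simp
      also have "\<dots> = (norm ?e)\<^sup>2 - 2 * \<rho> * (?e \<bullet> ?d) + \<rho>\<^sup>2 * (norm ?d)\<^sup>2"
        unfolding power2_norm_eq_inner
        by (simp add: inner_diff_left inner_diff_right inner_commute power2_eq_square algebra_simps)
      finally have "2 * \<rho> * (?e \<bullet> ?d - \<rho> / 2 * (norm ?d)\<^sup>2) \<le> (norm ?e)\<^sup>2"
        by (simp add: algebra_simps power2_eq_square)
      then show ?thesis using \<rho> by (simp add: field_simps)
    qed
    finally show ?thesis .
  qed
  show ?thesis
    by (rule that[of "\<lambda>q. ?V q (X q)" X]) (use X(3) lower upper in auto)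
qed

text \<open>On the domain the penalty lies between 0 and \<open>\<rho> * half_sq_radius f\<close>;
  each bound tests one problem with the maximizer of the other.\<close>

lemma smooth_conj_bounds:
  fixes f :: "'a::euclidean_space \<Rightarrow> ereal"
  assumes f: "proper_fun f" "lsc_fun f" "bounded (edom f)" and \<rho>: "0 \<le> \<rho>"
  shows "smooth_conj \<rho> f q \<le> fenchel_conj f q"
    "fenchel_conj f q \<le> smooth_conj \<rho> f q + ereal (\<rho> * half_sq_radius f)"
proof -
  obtain x where x: "x \<in> edom f"
    "\<And>y. y \<in> edom f \<Longrightarrow> q \<bullet> y - real_of_ereal (f y) - 0 / 2 * (norm y)\<^sup>2
        \<le> q \<bullet> x - real_of_ereal (f x) - 0 / 2 * (norm x)\<^sup>2"
    "smooth_conj 0 f q = ereal (q \<bullet> x - real_of_ereal (f x) - 0 / 2 * (norm x)\<^sup>2)"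
    using smooth_conj_attained[OF f, of q 0] by blast
  obtain z where z: "z \<in> edom f"
    "\<And>y. y \<in> edom f \<Longrightarrow> q \<bullet> y - real_of_ereal (f y) - \<rho> / 2 * (norm y)\<^sup>2
        \<le> q \<bullet> z - real_of_ereal (f z) - \<rho> / 2 * (norm z)\<^sup>2"
    "smooth_conj \<rho> f q = ereal (q \<bullet> z - real_of_ereal (f z) - \<rho> / 2 * (norm z)\<^sup>2)"
    using smooth_conj_attained[OF f, of q \<rho>] by blast
  have "0 \<le> \<rho> / 2 * (norm z)\<^sup>2"
    using \<rho> by simp
  with x(2)[OF z(1)] show "smooth_conj \<rho> f q \<le> fenchel_conj f q"
    by (simp add: fenchel_conj_eq_smooth_conj x(3) z(3))
  \<comment> \<open>The real-valued supremum in \<open>half_sq_radius\<close> dominates its members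
    once they are bounded above.\<close>
  obtain B where "\<And>y. y \<in> edom f \<Longrightarrow> norm y \<le> B"
    using f(3) by (auto simp: bounded_iff)
  then have "bdd_above ((\<lambda>y. (norm y)\<^sup>2 / 2) ` edom f)"
    by (intro bdd_aboveI2[of _ _ "B\<^sup>2 / 2"]) (simp add: power_mono)
  then have "(norm x)\<^sup>2 / 2 \<le> half_sq_radius f"
    unfolding half_sq_radius_def using x(1) by (rule cSUP_upper2) simp
  then have "\<rho> * ((norm x)\<^sup>2 / 2) \<le> \<rho> * half_sq_radius f"
    using \<rho> by (rule mult_left_mono)
  with z(2)[OF x(1)] show "fenchel_conj f q \<le> smooth_conj \<rho> f q + ereal (\<rho> * half_sq_radius f)"
    by (simp add: fenchel_conj_eq_smooth_conj x(3) z(3))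
qed

section \<open>Gradients and the adjoint\<close>

text \<open>This turns the two-sided quadratic bounds into differentiability: the error divided by
  \<open>norm (q - p)\<close> still vanishes in the limit.\<close>

lemma GDERIV_of_quadratic_error:
  fixes h :: "'a::real_inner \<Rightarrow> real"
  assumes "\<And>q. \<bar>h q - h p - (q - p) \<bullet> D\<bar> \<le> C * (norm (q - p))\<^sup>2"
  shows "GDERIV h p :> D"
  unfolding gderiv_def
proof (rule has_derivativeI_sandwich[where e = 1 and H = "\<lambda>q. C * norm (q - p)"])
  have "((\<lambda>q. C * norm (q - p)) \<longlongrightarrow> C * norm (p - p)) (at p)"
    by (intro tendsto_intros)
  then show "((\<lambda>q. C * norm (q - p)) \<longlongrightarrow> 0) (at p)"
    by simp
  show "norm (h q - h p - (q - p) \<bullet> D) / norm (q - p) \<le> C * norm (q - p)" if "q \<noteq> p" for q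
    using assms[of q] that by (simp add: field_simps power2_eq_square)
qed (auto intro: bounded_linear_inner_left)

lemma grad_eqI:
  assumes H: "\<And>q. H q = ereal (h q)" and D: "GDERIV h p :> D"
  shows "grad H p = D"
  unfolding grad_def
proof (rule the_equality)
  have "(\<lambda>q. real_of_ereal (H q)) = h"
    by (simp add: H)
  then show "(\<forall>\<^sub>F q in nhds p. \<bar>H q\<bar> \<noteq> \<infinity>) \<and> GDERIV (\<lambda>q. real_of_ereal (H q)) p :> D"
    using D by (simp add: H)
  fix E assume "(\<forall>\<^sub>F q in nhds p. \<bar>H q\<bar> \<noteq> \<infinity>) \<and> GDERIV (\<lambda>q. real_of_ereal (H q)) p :> E"
  then have "GDERIV h p :> E"
    by (simp add: H)
  then have "(\<lambda>v. v \<bullet> E) = (\<lambda>v. v \<bullet> D)"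
    using D unfolding gderiv_def by (rule has_derivative_unique)
  then show "E = D"
    by (metis vector_eq_ldot)
qed

text \<open>Cauchy-Schwarz applied to \<open>d \<bullet> A (adjoint A d)\<close>, followed by
  cancelling one factor \<open>norm (adjoint A d)\<close>; if that factor is 0, nonnegativity of the
  right side suffices.\<close>

lemma norm_adjoint_le:
  fixes A :: "'a::euclidean_space \<Rightarrow> 'b::euclidean_space"
  assumes "linear A"
  shows "norm (adjoint A d) \<le> onorm A * norm d"
proof -
  have "(norm (adjoint A d))\<^sup>2 = d \<bullet> A (adjoint A d)"
    by (simp add: power2_norm_eq_inner adjoint_clauses[OF assms] inner_commute)
  also have "\<dots> \<le> norm d * norm (A (adjoint A d))"
    by (rule norm_cauchy_schwarz)
  also have "\<dots> \<le> norm d * (onorm A * norm (adjoint A d))"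
    by (intro mult_left_mono onorm linear_conv_bounded_linear[THEN iffD1] assms) simp
  finally have "norm (adjoint A d) * norm (adjoint A d) \<le> onorm A * norm d * norm (adjoint A d)"
    by (simp add: power2_eq_square algebra_simps)
  moreover have "0 \<le> onorm A * norm d"
    using onorm_pos_le assms linear_conv_bounded_linear by (metis mult_nonneg_nonneg norm_ge_zero)
  ultimately show ?thesis
    by (metis mult_right_le_imp_le norm_ge_zero order_le_less)
qed

section \<open>The fast gradient method for strongly convex functions\<close>

text \<open>The step \<open>1 / L\<close> minimizes the quadratic upper model at \<open>w\<close>.
  Besides driving the method, this bounds gradients by function gaps.\<close>

lemma gradient_step_decrease:
  fixes G :: "'b::real_inner \<Rightarrow> 'b" and F :: "'b \<Rightarrow> real"
  assumes "0 < L"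
    and upper: "\<And>p p'. F p' - F p - (p' - p) \<bullet> G p \<le> L / 2 * (norm (p' - p))\<^sup>2"
  shows "F (w - (1 / L) *\<^sub>R G w) \<le> F w - (norm (G w))\<^sup>2 / (2 * L)"
proof -
  have "F (w - (1 / L) *\<^sub>R G w) - F w + (norm (G w))\<^sup>2 / L \<le> L / 2 * ((norm (G w))\<^sup>2 / L\<^sup>2)"
    using upper[of "w - (1 / L) *\<^sub>R G w" w] by (simp add: power2_norm_eq_inner power_divide)
  also have "\<dots> = (norm (G w))\<^sup>2 / (2 * L)"
    using assms(1) by (simp add: power2_eq_square)
  finally show ?thesis by simp
qed

text \<open>
  \<open>v\<close> is the auxiliary sequence of Nesterov's estimate functions, recovered from the two-term
  recursion as \<open>v\<^sub>k = w\<^sub>k + (w\<^sub>k - p\<^sub>k) / a\<close>.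
\<close>

lemma fast_gradient_lyapunov_step:
  fixes G :: "'b::real_inner \<Rightarrow> 'b" and F :: "'b \<Rightarrow> real"
  assumes "0 < \<kappa>" "\<kappa> \<le> L"
    and lower: "\<And>p p'. \<kappa> / 2 * (norm (p' - p))\<^sup>2 \<le> F p' - F p - (p' - p) \<bullet> G p"
    and upper: "\<And>p p'. F p' - F p - (p' - p) \<bullet> G p \<le> L / 2 * (norm (p' - p))\<^sup>2"
    and a: "a = sqrt (\<kappa> / L)"
    and w: "(1 + a) *\<^sub>R w = p + a *\<^sub>R v"
    and v': "v' = (1 - a) *\<^sub>R v + a *\<^sub>R w - (a / \<kappa>) *\<^sub>R G w"
  shows "F (w - (1 / L) *\<^sub>R G w) - F u + \<kappa> / 2 * (norm (v' - u))\<^sup>2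
    \<le> (1 - a) * (F p - F u + \<kappa> / 2 * (norm (v - u))\<^sup>2)"
proof -
  have L: "0 < L" using assms by simp
  have a01: "0 < a" "a \<le> 1" and a2: "a\<^sup>2 = \<kappa> / L"
    using assms by (auto simp: a)
  \<comment> \<open>Errors relative to \<open>u\<close>; \<open>c\<close> is the error of the new
    auxiliary point before its gradient correction.\<close>
  define x where "x = v - u"
  define y where "y = w - u"
  define c where "c = (1 - a) *\<^sub>R x + a *\<^sub>R y"
  have step: "F (w - (1 / L) *\<^sub>R G w) \<le> F w - (norm (G w))\<^sup>2 / (2 * L)"
    by (rule gradient_step_decrease[OF L upper])
  have lu: "\<kappa> / 2 * (norm y)\<^sup>2 \<le> F u - F w + y \<bullet> G w"
    using lower[of u w] by (simp add: y_def inner_diff_left norm_minus_commute)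
  have pw: "p - w = a *\<^sub>R (y - x)"
    using w by (simp add: x_def y_def algebra_simps)
  have lp: "0 \<le> F p - F w - a * ((y - x) \<bullet> G w)"
    using lower[of p w] assms(1) unfolding pw
    by (smt (verit) divide_pos_pos inner_scaleR_left mult_nonneg_nonneg zero_le_power2)
  have v'u: "v' - u = c - (a / \<kappa>) *\<^sub>R G w"
    by (simp add: v' c_def x_def y_def algebra_simps)
  have "(norm (v' - u))\<^sup>2 = (norm c)\<^sup>2 - 2 * (a / \<kappa>) * (c \<bullet> G w) + (a / \<kappa>)\<^sup>2 * (norm (G w))\<^sup>2"
    unfolding v'u power2_norm_eq_inner
    by (simp add: inner_diff_left inner_diff_right inner_commute power2_eq_square algebra_simps)
  \<comment> \<open>The choice of \<open>a\<close> makes the squared gradient term cancel exactly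
    against the decrease of the gradient step.\<close>
  moreover have "\<kappa> / 2 * (a / \<kappa>)\<^sup>2 = 1 / (2 * L)"
    using assms(1) L by (simp add: power_divide a2) (simp add: power2_eq_square)
  ultimately have nv: "\<kappa> / 2 * (norm (v' - u))\<^sup>2
      = \<kappa> / 2 * (norm c)\<^sup>2 - a * (c \<bullet> G w) + (norm (G w))\<^sup>2 / (2 * L)"
    using assms(1) by (simp add: distrib_left right_diff_distrib mult.assoc[symmetric])
  have nc: "(norm c)\<^sup>2 = (1 - a) * (norm x)\<^sup>2 + a * (norm y)\<^sup>2 - a * (1 - a) * (norm (x - y))\<^sup>2"
    unfolding power2_norm_eq_inner c_def
    by (simp add: inner_add_left inner_add_right inner_diff_left inner_diff_right inner_commute algebra_simps)
  have "0 \<le> a * (1 - a) * (norm (x - y))\<^sup>2"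
    using a01 by simp
  then have "\<kappa> / 2 * (norm c)\<^sup>2 \<le> \<kappa> / 2 * ((1 - a) * (norm x)\<^sup>2 + a * (norm y)\<^sup>2)"
    unfolding nc using assms(1) by (intro mult_left_mono) auto
  \<comment> \<open>Weighting the lower bounds at \<open>p\<close> and \<open>u\<close> by
    \<open>1 - a\<close> and \<open>a\<close> cancels all inner products with \<open>G w\<close> and
    the \<open>norm y\<close> terms.\<close>
  moreover have "(1 - a) * F w \<le> (1 - a) * (F p - a * ((y - x) \<bullet> G w))"
    using lp a01 by (intro mult_left_mono) auto
  moreover have "a * (\<kappa> / 2 * (norm y)\<^sup>2) \<le> a * (F u - F w + y \<bullet> G w)"
    using lu a01 by (intro mult_left_mono) auto
  moreover have "a * (c \<bullet> G w) = a * ((1 - a) * (x \<bullet> G w) + a * (y \<bullet> G w))"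
    by (simp add: c_def inner_add_left)
  moreover have "F (w - (1 / L) *\<^sub>R G w) + \<kappa> / 2 * (norm (v' - u))\<^sup>2
      \<le> F w + \<kappa> / 2 * (norm c)\<^sup>2 - a * (c \<bullet> G w)"
    using step nv by linarith
  ultimately show ?thesis
    unfolding x_def[symmetric] by (simp add: inner_diff_left algebra_simps diff_divide_distrib)
qed

text \<open>The gap plus \<kappa>/2 times the squared distance of \<open>V k\<close> from
  \<open>u\<close> shrinks by the factor \<open>1 - a\<close> in each iteration. The bulk of the
  proof matches the momentum form of the method with the recursion for \<open>V\<close>.\<close>

lemma fast_gradient_convergence:
  fixes G :: "'b::real_inner \<Rightarrow> 'b" and F :: "'b \<Rightarrow> real"
  assumes \<kappa>: "0 < \<kappa>" "\<kappa> \<le> L"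
    and lower: "\<And>p p'. \<kappa> / 2 * (norm (p' - p))\<^sup>2 \<le> F p' - F p - (p' - p) \<bullet> G p"
    and upper: "\<And>p p'. F p' - F p - (p' - p) \<bullet> G p \<le> L / 2 * (norm (p' - p))\<^sup>2"
  shows "F (fst (fast_gradient G L \<kappa> k)) - F u
    \<le> (1 - sqrt (\<kappa> / L)) ^ k * (F 0 - F u + \<kappa> / 2 * (norm u)\<^sup>2)"
proof -
  define a where "a = sqrt (\<kappa> / L)"
  define P where "P = (\<lambda>k. fst (fast_gradient G L \<kappa> k))"
  define W where "W = (\<lambda>k. snd (fast_gradient G L \<kappa> k))"
  define V where "V = (\<lambda>k. W k + (1 / a) *\<^sub>R (W k - P k))"
  have L: "0 < L" using \<kappa> by simp
  have a: "0 < a" "a \<le> 1" and a2: "a\<^sup>2 = \<kappa> / L"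
    using \<kappa> L by (auto simp: a_def)
  have \<beta>: "(sqrt L - sqrt \<kappa>) / (sqrt L + sqrt \<kappa>) = (1 - a) / (1 + a)"
  proof -
    have s: "sqrt \<kappa> = a * sqrt L"
      using L by (simp add: a_def real_sqrt_divide)
    have "(sqrt L - sqrt \<kappa>) / (sqrt L + sqrt \<kappa>) = ((1 - a) * sqrt L) / ((1 + a) * sqrt L)"
      unfolding s by (simp add: algebra_simps)
    then show ?thesis using L by simp
  qed
  have P_Suc: "P (Suc k) = W k - (1 / L) *\<^sub>R G (W k)" for k
    by (simp add: P_def W_def Let_def split: prod.split)
  have W_Suc: "W (Suc k) = P (Suc k) + ((1 - a) / (1 + a)) *\<^sub>R (P (Suc k) - P k)" for k
    unfolding \<beta>[symmetric] by (simp add: P_def W_def Let_def split: prod.split)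
  have W: "(1 + a) *\<^sub>R W k = P k + a *\<^sub>R V k" for k
    using a by (simp add: V_def algebra_simps)
  have V_Suc: "V (Suc k) = (1 - a) *\<^sub>R V k + a *\<^sub>R W k - (a / \<kappa>) *\<^sub>R G (W k)" for k
  proof -
    let ?d = "P (Suc k) - P k"
    \<comment> \<open>The momentum coefficient is the one for which \<open>V (Suc k)\<close>
      extrapolates the step from \<open>P k\<close> to \<open>P (Suc k)\<close> by the factor
      \<open>1 / a\<close>.\<close>
    have "V (Suc k) = P (Suc k) + ((1 + 1 / a) * ((1 - a) / (1 + a))) *\<^sub>R ?d"
      by (simp only: V_def W_Suc add_diff_cancel_left' scaleR_add_left scaleR_scaleR distrib_right
          mult_1_left add.assoc)
    also have "(1 + 1 / a) * ((1 - a) / (1 + a)) = 1 / a - 1"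
    proof -
      have "1 + 1 / a = (1 + a) / a"
        using a by (simp add: field_simps)
      then have "(1 + 1 / a) * ((1 - a) / (1 + a)) = (1 - a) / a"
        using a by simp
      also have "\<dots> = 1 / a - 1"
        using a by (simp add: diff_divide_distrib)
      finally show ?thesis .
    qed
    also have "P (Suc k) + (1 / a - 1) *\<^sub>R ?d = P k + (1 / a) *\<^sub>R ?d"
      by (simp add: algebra_simps)
    finally have V1: "a *\<^sub>R V (Suc k) = a *\<^sub>R P k + ?d"
      using a by (simp add: scaleR_add_right)
    have Pk: "P k = (1 + a) *\<^sub>R W k - a *\<^sub>R V k"
      using W[of k] by simp
    have "1 / L = a * (a / \<kappa>)"
      using a2 \<kappa> L by (simp add: power2_eq_square field_simps)
    then have "a *\<^sub>R V (Suc k) = a *\<^sub>R ((1 - a) *\<^sub>R V k + a *\<^sub>R W k - (a / \<kappa>) *\<^sub>R G (W k))"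
      unfolding V1 P_Suc Pk by (simp add: algebra_simps)
    then show ?thesis using a by simp
  qed
  have "F (P k) - F u + \<kappa> / 2 * (norm (V k - u))\<^sup>2 \<le> (1 - a) ^ k * (F 0 - F u + \<kappa> / 2 * (norm u)\<^sup>2)"
  proof (induction k)
    case 0
    \<comment> \<open>Both sequences start at 0, so \<open>V 0 = 0\<close>.\<close>
    then show ?case by (simp add: P_def V_def W_def)
  next
    case (Suc k)
    have "F (P (Suc k)) - F u + \<kappa> / 2 * (norm (V (Suc k) - u))\<^sup>2
        \<le> (1 - a) * (F (P k) - F u + \<kappa> / 2 * (norm (V k - u))\<^sup>2)"
      unfolding P_Suc
      by (rule fast_gradient_lyapunov_step[OF \<kappa> lower upper a_def W V_Suc])
    also have "\<dots> \<le> (1 - a) * ((1 - a) ^ k * (F 0 - F u + \<kappa> / 2 * (norm u)\<^sup>2))"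
      using Suc.IH a by (intro mult_left_mono) auto
    finally show ?case by (simp add: mult.assoc)
  qed
  moreover have "0 \<le> \<kappa> / 2 * (norm (V k - u))\<^sup>2"
    using \<kappa> by simp
  ultimately have "F (P k) - F u \<le> (1 - a) ^ k * (F 0 - F u + \<kappa> / 2 * (norm u)\<^sup>2)"
    by linarith
  then show ?thesis
    by (simp only: P_def a_def)
qed

section \<open>Minimizers and near-stationarity\<close>

text \<open>Outside the ball of radius \<open>2 * norm (G 0) / \<kappa>\<close> the quadratic lower
  bound at 0 already forces \<open>F\<close> to be at least \<open>F 0\<close>, so a minimizer on
  the ball is global.\<close>

lemma strongly_convex_minimizer:
  fixes G :: "'b::euclidean_space \<Rightarrow> 'b" and F :: "'b \<Rightarrow> real"
  assumes \<kappa>: "0 < \<kappa>" and cont: "continuous_on UNIV F"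
    and lower: "\<And>p p'. \<kappa> / 2 * (norm (p' - p))\<^sup>2 \<le> F p' - F p - (p' - p) \<bullet> G p"
  obtains u where "\<And>p. F u \<le> F p"
proof -
  define r where "r = 2 * norm (G 0) / \<kappa>"
  have "0 \<le> r" using \<kappa> by (simp add: r_def)
  then have "cball 0 r \<noteq> ({} :: 'b set)"
    by simp
  from continuous_attains_inf[OF compact_cball this continuous_on_subset[OF cont subset_UNIV]]
  obtain u where u: "\<And>p. p \<in> cball 0 r \<Longrightarrow> F u \<le> F p"
    by blast
  have "F u \<le> F p" for p
  proof (cases "p \<in> cball 0 r")
    case False
    then have "2 * norm (G 0) \<le> \<kappa> * norm p"
      using \<kappa> by (simp add: r_def field_simps)
    then have "norm p * (2 * norm (G 0)) \<le> norm p * (\<kappa> * norm p)"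
      by (rule mult_left_mono) simp
    moreover have "- (norm p * norm (G 0)) \<le> p \<bullet> G 0"
      using Cauchy_Schwarz_ineq2[of p "G 0"] by linarith
    moreover have "\<kappa> / 2 * (norm p)\<^sup>2 \<le> F p - F 0 - p \<bullet> G 0"
      using lower[of p 0] by simp
    ultimately have "F 0 \<le> F p"
      by (simp add: power2_eq_square algebra_simps)
    then show ?thesis using u[of 0] \<open>0 \<le> r\<close> by simp
  qed (rule u)
  then show ?thesis by (rule that)
qed

text \<open>\<open>G p - \<kappa> *\<^sub>R p\<close> removes the gradient of the regularizer. The
  radius bound is assumed for every minimizer because \<open>u\<close> is only obtained inside the
  proof.\<close>

lemma fast_gradient_near_stationary:
  fixes G :: "'b::euclidean_space \<Rightarrow> 'b" and F :: "'b \<Rightarrow> real"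
  assumes \<kappa>: "0 < \<kappa>" "\<kappa> \<le> L" and cont: "continuous_on UNIV F"
    and lower: "\<And>p p'. \<kappa> / 2 * (norm (p' - p))\<^sup>2 \<le> F p' - F p - (p' - p) \<bullet> G p"
    and upper: "\<And>p p'. F p' - F p - (p' - p) \<bullet> G p \<le> L / 2 * (norm (p' - p))\<^sup>2"
    and \<Delta>: "\<And>p. F 0 - F p \<le> \<Delta>"
    and radius: "\<And>u. (\<And>p. F u \<le> F p) \<Longrightarrow> norm u \<le> r"
    and k: "2 * L * (2 * \<Delta> * exp (- (real k * sqrt (\<kappa> / L)))) \<le> \<delta>\<^sup>2" and \<delta>: "0 \<le> \<delta>"
  defines "p \<equiv> fst (fast_gradient G L \<kappa> k)"
  shows "norm (G p - \<kappa> *\<^sub>R p) \<le> 2 * \<delta> + \<kappa> * r"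
proof -
  obtain u where u: "\<And>p. F u \<le> F p"
    using strongly_convex_minimizer[OF \<kappa>(1) cont lower] by blast
  have L: "0 < L" using \<kappa> by simp
  \<comment> \<open>Otherwise a gradient step from \<open>u\<close> would go below the
    minimum.\<close>
  have Gu: "G u = 0"
  proof -
    have "(norm (G u))\<^sup>2 / (2 * L) \<le> 0"
      using gradient_step_decrease[OF L upper, of u] u[of "u - (1 / L) *\<^sub>R G u"] by linarith
    then show ?thesis using L by (simp add: divide_le_0_iff)
  qed
  let ?q = "sqrt (\<kappa> / L)"
  have q: "0 \<le> 1 - ?q" "1 - ?q \<le> exp (- ?q)"
    using \<kappa> L exp_ge_add_one_self[of "- ?q"] by auto
  \<comment> \<open>The distance part of the initial Lyapunov value is at most the initial gap,
    whence the factor 2 before \<open>\<Delta>\<close>.\<close>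
  have half: "\<kappa> / 2 * (norm u)\<^sup>2 \<le> F 0 - F u"
    using lower[of 0 u] Gu by simp
  have "F p - F u \<le> (1 - ?q) ^ k * (F 0 - F u + \<kappa> / 2 * (norm u)\<^sup>2)"
    unfolding p_def by (rule fast_gradient_convergence[OF \<kappa> lower upper])
  also have "\<dots> \<le> exp (- ?q) ^ k * (2 * \<Delta>)"
    using half \<Delta>[of u] q u[of 0] \<kappa> by (intro mult_mono power_mono) auto
  also have "exp (- ?q) ^ k = exp (- (real k * ?q))"
    by (simp add: exp_of_nat_mult[symmetric])
  finally have gap: "2 * L * (F p - F u) \<le> \<delta>\<^sup>2"
    using k L by (smt (verit) mult.commute mult_left_mono)
  have "(norm (G p))\<^sup>2 / (2 * L) \<le> F p - F u"
    using gradient_step_decrease[OF L upper, of p] u[of "p - (1 / L) *\<^sub>R G p"] by linarith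
  then have "(norm (G p))\<^sup>2 \<le> 2 * L * (F p - F u)"
    using L by (simp add: field_simps)
  then have Gp: "norm (G p) \<le> \<delta>"
    using gap \<delta> by (meson order_trans power2_le_imp_le)
  have "\<kappa> / 2 * (norm (p - u))\<^sup>2 \<le> F p - F u"
    using lower[of p u] Gu by simp
  \<comment> \<open>Scaling by \<open>2 * \<kappa>\<close> and using \<open>\<kappa> \<le> L\<close>
    lets the same gap estimate control the distance as well as the gradient.\<close>
  then have "2 * \<kappa> * (\<kappa> / 2 * (norm (p - u))\<^sup>2) \<le> 2 * \<kappa> * (F p - F u)"
    using \<kappa> by (intro mult_left_mono) auto
  then have "(\<kappa> * norm (p - u))\<^sup>2 \<le> 2 * \<kappa> * (F p - F u)"
    by (simp add: power2_eq_square mult.assoc mult.left_commute)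
  also have "\<dots> \<le> 2 * L * (F p - F u)"
    using \<kappa> u[of p] by (intro mult_right_mono) auto
  finally have pu: "\<kappa> * norm (p - u) \<le> \<delta>"
    using gap \<delta> by (meson order_trans power2_le_imp_le)
  have "norm (G p - \<kappa> *\<^sub>R p) = norm (G p - \<kappa> *\<^sub>R (p - u) - \<kappa> *\<^sub>R u)"
    by (simp add: algebra_simps)
  also have "\<dots> \<le> norm (G p) + \<kappa> * norm (p - u) + \<kappa> * norm u"
    using norm_triangle_ineq4[of "G p - \<kappa> *\<^sub>R (p - u)" "\<kappa> *\<^sub>R u"]
      norm_triangle_ineq4[of "G p" "\<kappa> *\<^sub>R (p - u)"] \<kappa> by simp
  also have "\<dots> \<le> 2 * \<delta> + \<kappa> * r"
    using Gp pu radius[OF u] \<kappa> by (smt (verit) mult_left_mono)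
  finally show ?thesis .
qed

section \<open>Double smoothing of the dual objective\<close>

text \<open>The chain rule for \<open>adjoint A\<close> and negation gives the gradient
  \<open>A (Xf (adjoint A p)) - Xg (- p)\<close>. Remainders add up, and the norm of the adjoint
  produces the square of \<open>onorm A\<close>.\<close>

lemma theta_smooth_sandwich:
  fixes f :: "'a::euclidean_space \<Rightarrow> ereal" and g :: "'b::euclidean_space \<Rightarrow> ereal"
  assumes f: "proper_fun f" "convex_fun f" "lsc_fun f" "bounded (edom f)"
    and g: "proper_fun g" "convex_fun g" "lsc_fun g" "bounded (edom g)"
    and A: "linear A" and "0 < \<rho>" "0 < \<mu>"
  obtains h G where "\<And>p. theta_smooth f g A \<rho> \<mu> p = ereal (h p)"
    "\<And>p p'. 0 \<le> h p' - h p - (p' - p) \<bullet> G p"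
    "\<And>p p'. h p' - h p - (p' - p) \<bullet> G p \<le> ((onorm A)\<^sup>2 / \<rho> + 1 / \<mu>) / 2 * (norm (p' - p))\<^sup>2"
proof -
  obtain hf Xf where hf: "\<And>q. smooth_conj \<rho> f q = ereal (hf q)"
    "\<And>q q'. 0 \<le> hf q' - hf q - (q' - q) \<bullet> Xf q"
    "\<And>q q'. hf q' - hf q - (q' - q) \<bullet> Xf q \<le> (norm (q' - q))\<^sup>2 / (2 * \<rho>)"
    using smooth_conj_sandwich[OF f \<open>0 < \<rho>\<close>] by metis
  obtain hg Xg where hg: "\<And>q. smooth_conj \<mu> g q = ereal (hg q)"
    "\<And>q q'. 0 \<le> hg q' - hg q - (q' - q) \<bullet> Xg q"
    "\<And>q q'. hg q' - hg q - (q' - q) \<bullet> Xg q \<le> (norm (q' - q))\<^sup>2 / (2 * \<mu>)"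
    using smooth_conj_sandwich[OF g \<open>0 < \<mu>\<close>] by metis
  define h where "h = (\<lambda>p. hf (adjoint A p) + hg (- p))"
  define G where "G = (\<lambda>p. A (Xf (adjoint A p)) - Xg (- p))"
  have adj: "adjoint A p' - adjoint A p = adjoint A (p' - p)" for p p'
    using adjoint_linear[OF A] by (simp add: linear_diff)
  have split: "h p' - h p - (p' - p) \<bullet> G p =
      (hf (adjoint A p') - hf (adjoint A p) - (adjoint A p' - adjoint A p) \<bullet> Xf (adjoint A p)) +
      (hg (- p') - hg (- p) - (- p' - - p) \<bullet> Xg (- p))" for p p'
    unfolding adj h_def G_def
    by (simp add: adjoint_clauses[OF A] inner_diff_right inner_diff_left algebra_simps)
  show ?thesis
  proof (rule that)
    show "theta_smooth f g A \<rho> \<mu> p = ereal (h p)" for p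
      by (simp add: theta_smooth_def h_def hf(1) hg(1))
    show "0 \<le> h p' - h p - (p' - p) \<bullet> G p" for p p'
      unfolding split by (intro add_nonneg_nonneg hf(2) hg(2))
    show "h p' - h p - (p' - p) \<bullet> G p \<le> ((onorm A)\<^sup>2 / \<rho> + 1 / \<mu>) / 2 * (norm (p' - p))\<^sup>2" for p p'
    proof -
      have "(norm (adjoint A (p' - p)))\<^sup>2 \<le> (onorm A * norm (p' - p))\<^sup>2"
        by (intro power_mono norm_adjoint_le A) simp
      then have "(norm (adjoint A (p' - p)))\<^sup>2 / (2 * \<rho>) \<le> (onorm A)\<^sup>2 * (norm (p' - p))\<^sup>2 / (2 * \<rho>)"
        using \<open>0 < \<rho>\<close> by (intro divide_right_mono) (auto simp: power_mult_distrib)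
      moreover have "norm (- p' - - p) = norm (p' - p)"
        by (simp add: norm_minus_commute)
      ultimately show ?thesis
        unfolding split using hf(3)[of "adjoint A p'" "adjoint A p"] hg(3)[of "- p'" "- p"]
        unfolding adj by (simp add: add_divide_distrib distrib_right)
    qed
  qed
qed

lemma fenchel_conj_finite:
  fixes f :: "'a::euclidean_space \<Rightarrow> ereal"
  assumes "proper_fun f" "lsc_fun f" "bounded (edom f)"
  shows "\<exists>r. fenchel_conj f q = ereal r"
  using smooth_conj_attained[OF assms, of q 0]
  unfolding fenchel_conj_eq_smooth_conj by (elim bexE conjE) (rule exI)

text \<open>Attainment makes both conjugates real-valued, so the dual objective is the negative of a
  real function \<open>th\<close>.\<close>

lemma dual_solution_minimizes_theta:
  fixes f :: "'a::euclidean_space \<Rightarrow> ereal" and g :: "'b::euclidean_space \<Rightarrow> ereal"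
  assumes f: "proper_fun f" "lsc_fun f" "bounded (edom f)"
    and g: "proper_fun g" "lsc_fun g" "bounded (edom g)"
    and opt: "dual_solution f g A pstar"
  obtains th where "\<And>p. theta f g A p = ereal (th p)" "\<And>p. th pstar \<le> th p"
proof -
  obtain hf where hf: "\<And>q. fenchel_conj f q = ereal (hf q)"
    using fenchel_conj_finite[OF f] by metis
  obtain hg where hg: "\<And>q. fenchel_conj g q = ereal (hg q)"
    using fenchel_conj_finite[OF g] by metis
  have obj: "dual_objective f g A p = ereal (- (hf (adjoint A p) + hg (- p)))" for p
    by (simp add: dual_objective_def hf hg)
  have "dual_objective f g A p \<le> dual_objective f g A pstar" for p
    using opt unfolding dual_solution_def by (metis SUP_upper UNIV_I)
  then have "hf (adjoint A pstar) + hg (- pstar) \<le> hf (adjoint A p) + hg (- p)" for p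
    unfolding obj by (simp del: minus_add_distrib)
  then show ?thesis
    by (intro that[of "\<lambda>p. hf (adjoint A p) + hg (- p)"]) (auto simp: theta_def hf hg)
qed

section \<open>Iteration count and final gradient bound\<close>

text \<open>Since \<open>\<kappa> / L = \<epsilon>\<^sup>2 / T\<close>, the bound on
  \<open>k\<close> says that the decay is at most \<open>1 / z ^ 3\<close>, and \<open>z\<close> is
  the cube root for which \<open>4 * L * \<Delta> / z ^ 3\<close> equals the squared
  tolerance.\<close>

lemma iteration_bound_exp_decay:
  fixes \<epsilon> R S \<Delta> :: real
  assumes pos: "0 < \<epsilon>" "0 < R" "0 \<le> S" "0 < \<Delta>"
    and k: "real k \<ge> 3 / \<epsilon> * sqrt (\<epsilon>\<^sup>2 + 8 * R\<^sup>2 * S) *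
      ln (root 3 ((2 * \<epsilon>\<^sup>2 + 16 * R\<^sup>2 * S) * \<Delta>) / ((2 - sqrt 3) powr (2 / 3) * \<epsilon>))"
    and L: "L = (\<epsilon>\<^sup>2 + 8 * R\<^sup>2 * S) / (2 * R\<^sup>2 * \<epsilon>)" and \<kappa>: "\<kappa> = \<epsilon> / (2 * R\<^sup>2)"
  shows "2 * L * (2 * \<Delta> * exp (- (real k * sqrt (\<kappa> / L)))) \<le> ((2 - sqrt 3) * \<epsilon> / R)\<^sup>2"
proof -
  define T where "T = \<epsilon>\<^sup>2 + 8 * R\<^sup>2 * S"
  define c :: real where "c = 2 - sqrt 3"
  define z where "z = root 3 (2 * T * \<Delta>) / (c powr (2 / 3) * \<epsilon>)"
  have T: "0 < T"
    using pos by (simp add: T_def add_pos_nonneg)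
  have c: "0 < c"
    unfolding c_def using real_sqrt_less_mono[of 3 4] by simp
  have z: "0 < z"
    using T c pos by (simp add: z_def)
  have z3: "z ^ 3 = 2 * T * \<Delta> / (c\<^sup>2 * \<epsilon> ^ 3)"
    using T c pos by (simp add: z_def power_divide power_mult_distrib powr_power)
  have T2: "2 * T = 2 * \<epsilon>\<^sup>2 + 16 * R\<^sup>2 * S"
    by (simp add: T_def)
  have k: "3 / \<epsilon> * sqrt T * ln z \<le> real k"
    using k unfolding z_def c_def T2 unfolding T_def .
  have "\<kappa> / L = \<epsilon>\<^sup>2 / T"
    using pos unfolding \<kappa> L T_def[symmetric] by (simp add: power2_eq_square)
  then have q: "sqrt (\<kappa> / L) = \<epsilon> / sqrt T"
    using pos by (simp add: real_sqrt_divide)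
  \<comment> \<open>The factor \<open>\<epsilon> / sqrt T\<close> is positive, so the sign of
    \<open>ln z\<close> does not matter.\<close>
  have "3 / \<epsilon> * sqrt T * ln z * (\<epsilon> / sqrt T) \<le> real k * (\<epsilon> / sqrt T)"
    using k T pos by (intro mult_right_mono) auto
  then have "real 3 * ln z \<le> real k * sqrt (\<kappa> / L)"
    using T pos by (simp add: q)
  then have "exp (- (real k * sqrt (\<kappa> / L))) \<le> exp (- (real 3 * ln z))"
    by simp
  also have "\<dots> = 1 / z ^ 3"
    using z by (simp only: exp_minus exp_of_nat_mult exp_ln inverse_eq_divide)
  finally have "4 * L * \<Delta> * exp (- (real k * sqrt (\<kappa> / L))) \<le> 4 * L * \<Delta> * (1 / z ^ 3)"
    using T pos unfolding L T_def[symmetric] by (intro mult_left_mono) auto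
  also have "\<dots> = (c * \<epsilon> / R)\<^sup>2"
    unfolding z3 L T_def[symmetric] using T c pos
    by (simp add: power2_eq_square power3_eq_cube field_simps)
  finally show ?thesis
    by (simp add: c_def mult.assoc)
qed

lemma double_smoothing_gradient_bound:
  fixes f :: "'a::euclidean_space \<Rightarrow> ereal" and g :: "'b::euclidean_space \<Rightarrow> ereal"
  assumes f: "proper_fun f" "convex_fun f" "lsc_fun f" "bounded (edom f)"
    and g: "proper_fun g" "convex_fun g" "lsc_fun g" "bounded (edom g)"
    and A: "linear A" and opt: "dual_solution f g A pstar"
    and R: "0 < R" "norm pstar \<le> R"
    and D: "0 < half_sq_radius f" "0 < half_sq_radius g" and \<epsilon>: "0 < \<epsilon>"
  defines "S \<equiv> (onorm A)\<^sup>2 * half_sq_radius f + half_sq_radius g"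
    and "\<Delta> \<equiv> real_of_ereal (theta f g A 0) - real_of_ereal (theta f g A pstar) + \<epsilon> / 2"
    and "\<rho> \<equiv> \<epsilon> / (4 * half_sq_radius f)" and "\<mu> \<equiv> \<epsilon> / (4 * half_sq_radius g)"
    and "\<kappa> \<equiv> \<epsilon> / (2 * R\<^sup>2)"
  assumes k: "real k \<ge> 3 / \<epsilon> * sqrt (\<epsilon>\<^sup>2 + 8 * R\<^sup>2 * S) *
      ln (root 3 ((2 * \<epsilon>\<^sup>2 + 16 * R\<^sup>2 * S) * \<Delta>) / ((2 - sqrt 3) powr (2 / 3) * \<epsilon>))"
  shows "norm (grad (theta_smooth f g A \<rho> \<mu>) (dual_iterate f g A \<rho> \<mu> \<kappa> k)) \<le> 2 * \<epsilon> / R"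
proof -
  define L where "L = lipschitz_const A \<rho> \<mu> \<kappa>"
  have pos: "0 < \<rho>" "0 < \<mu>" "0 < \<kappa>"
    using D \<epsilon> R by (simp_all add: \<rho>_def \<mu>_def \<kappa>_def)
  obtain h G where h: "\<And>p. theta_smooth f g A \<rho> \<mu> p = ereal (h p)"
    and hl: "\<And>p p'. 0 \<le> h p' - h p - (p' - p) \<bullet> G p"
    and hu: "\<And>p p'. h p' - h p - (p' - p) \<bullet> G p \<le> ((onorm A)\<^sup>2 / \<rho> + 1 / \<mu>) / 2 * (norm (p' - p))\<^sup>2"
    using theta_smooth_sandwich[OF f g A pos(1,2)] by metis
  obtain th where th: "\<And>p. theta f g A p = ereal (th p)" and min: "\<And>p. th pstar \<le> th p"
    using dual_solution_minimizes_theta[OF f(1,3,4) g(1,3,4) opt] by metis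
  have h_le: "h p \<le> th p" for p
  proof -
    have "theta_smooth f g A \<rho> \<mu> p \<le> theta f g A p"
      unfolding theta_smooth_def theta_def
      using smooth_conj_bounds(1)[OF f(1,3,4)] smooth_conj_bounds(1)[OF g(1,3,4)] pos
      by (intro add_mono) auto
    then show ?thesis by (simp add: h th)
  qed
  have le_h: "th p \<le> h p + \<epsilon> / 2" for p
  proof -
    have "theta f g A p \<le> (smooth_conj \<rho> f (adjoint A p) + ereal (\<rho> * half_sq_radius f))
        + (smooth_conj \<mu> g (- p) + ereal (\<mu> * half_sq_radius g))"
      unfolding theta_def
      using smooth_conj_bounds(2)[OF f(1,3,4)] smooth_conj_bounds(2)[OF g(1,3,4)] pos
      by (intro add_mono) auto
    also have "\<dots> = theta_smooth f g A \<rho> \<mu> p + ereal (\<rho> * half_sq_radius f + \<mu> * half_sq_radius g)"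
      unfolding theta_smooth_def by (simp add: ac_simps flip: plus_ereal.simps(1))
    \<comment> \<open>The parameters give each of the two smoothings an error budget of
      \<epsilon>/4.\<close>
    also have "\<rho> * half_sq_radius f + \<mu> * half_sq_radius g = \<epsilon> / 2"
      using D by (simp add: \<rho>_def \<mu>_def)
    finally show ?thesis by (simp add: h th)
  qed
  define F where "F = (\<lambda>p. h p + \<kappa> / 2 * (norm p)\<^sup>2)"
  define GF where "GF = (\<lambda>p. G p + \<kappa> *\<^sub>R p)"
  \<comment> \<open>The linearization error of the regularizer is exactly quadratic, so \<kappa>
    adds to both the lower and the upper constant.\<close>
  have F_split: "F p' - F p - (p' - p) \<bullet> GF p
      = (h p' - h p - (p' - p) \<bullet> G p) + \<kappa> / 2 * (norm (p' - p))\<^sup>2" for p p'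
    unfolding F_def GF_def power2_norm_eq_inner
    by (simp add: inner_add_left inner_add_right inner_diff_left inner_diff_right inner_commute
        algebra_simps diff_divide_distrib add_divide_distrib)
  have lower: "\<kappa> / 2 * (norm (p' - p))\<^sup>2 \<le> F p' - F p - (p' - p) \<bullet> GF p" for p p'
    unfolding F_split using hl[of p' p] by simp
  have upper: "F p' - F p - (p' - p) \<bullet> GF p \<le> L / 2 * (norm (p' - p))\<^sup>2" for p p'
    unfolding F_split using hu[of p' p]
    by (simp add: L_def lipschitz_const_def algebra_simps add_divide_distrib)
  have gradF: "GDERIV F p :> GF p" for p
  proof (rule GDERIV_of_quadratic_error)
    fix q
    have "0 \<le> \<kappa> / 2 * (norm (q - p))\<^sup>2"
      using pos by simp
    then show "\<bar>F q - F p - (q - p) \<bullet> GF p\<bar> \<le> L / 2 * (norm (q - p))\<^sup>2"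
      using lower[of q p] upper[of q p] by linarith
  qed
  have "GDERIV h p :> G p" for p
    by (rule GDERIV_of_quadratic_error[where C = "((onorm A)\<^sup>2 / \<rho> + 1 / \<mu>) / 2"])
      (simp only: abs_of_nonneg[OF hl] hu)
  then have grad_h: "grad (theta_smooth f g A \<rho> \<mu>) p = G p" for p
    by (rule grad_eqI[OF h])
  have "theta_double_smooth f g A \<rho> \<mu> \<kappa> p = ereal (F p)" for p
    by (simp add: theta_double_smooth_def h F_def)
  then have grad_F: "grad (theta_double_smooth f g A \<rho> \<mu> \<kappa>) = GF"
    using grad_eqI gradF by blast
  have cont: "continuous_on UNIV F"
    using gradF unfolding gderiv_def
    by (intro has_derivative_continuous_on) (auto intro: has_derivative_at_withinI)
  have L: "L = (\<epsilon>\<^sup>2 + 8 * R\<^sup>2 * S) / (2 * R\<^sup>2 * \<epsilon>)"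
    using \<epsilon> R D unfolding L_def lipschitz_const_def \<rho>_def \<mu>_def \<kappa>_def S_def
    by (simp add: field_simps power2_eq_square)
  have \<Delta>: "\<Delta> = th 0 - th pstar + \<epsilon> / 2"
    by (simp add: \<Delta>_def th)
  have "0 \<le> S" "0 < \<Delta>"
    using D min[of 0] \<epsilon> by (simp_all add: S_def \<Delta>)
  note decay = iteration_bound_exp_decay[OF \<epsilon> R(1) this k L \<kappa>_def[THEN meta_eq_to_obj_eq]]
  have \<kappa>L: "\<kappa> \<le> L"
    using pos by (simp add: L_def lipschitz_const_def)
  have gap: "F 0 - F p \<le> \<Delta>" for p
  proof -
    have "0 \<le> \<kappa> / 2 * (norm p)\<^sup>2"
      using pos by simp
    then show ?thesis
      using h_le[of 0] le_h[of p] min[of p] by (simp add: F_def \<Delta>)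
  qed
  \<comment> \<open>Comparing with \<open>pstar\<close> costs \<epsilon>/2 for the smoothing and
    \<epsilon>/4 for the regularizer, so \<open>\<kappa> / 2 * (norm u)\<^sup>2\<close> is at most
    3\<epsilon>/4.\<close>
  have radius: "norm u \<le> sqrt 3 * R" if "\<And>p. F u \<le> F p" for u
  proof -
    have "(norm pstar)\<^sup>2 \<le> R\<^sup>2"
      using R by (intro power_mono) auto
    then have "\<kappa> / 2 * (norm pstar)\<^sup>2 \<le> \<kappa> / 2 * R\<^sup>2"
      using pos by (intro mult_left_mono) auto
    also have "\<dots> = \<epsilon> / 4"
      using R by (simp add: \<kappa>_def)
    finally have "\<kappa> / 2 * (norm u)\<^sup>2 \<le> 3 * \<epsilon> / 4"
      using that[of pstar] h_le[of pstar] le_h[of u] min[of u] by (simp add: F_def)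
    then have "(norm u)\<^sup>2 \<le> (sqrt 3 * R)\<^sup>2"
      using R \<epsilon> by (simp add: \<kappa>_def power_mult_distrib field_simps)
    then show ?thesis
      by (rule power2_le_imp_le) (use R in simp)
  qed
  define p where "p = dual_iterate f g A \<rho> \<mu> \<kappa> k"
  have p: "p = fst (fast_gradient GF L \<kappa> k)"
    by (simp add: p_def dual_iterate_def grad_F L_def)
  \<comment> \<open>This is exactly what makes \<open>4 - 3 / 2 * sqrt 3\<close> at most 2 below;
    \<open>sqrt 3 \<le> 2\<close> keeps the tolerance nonnegative.\<close>
  have "4 / 3 \<le> sqrt 3"
    by (rule real_le_rsqrt) (simp add: power2_eq_square)
  moreover have "sqrt 3 \<le> 2"
    by (rule real_le_lsqrt) simp_all
  ultimately have s3: "4 / 3 \<le> sqrt 3" "sqrt 3 \<le> 2" .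
  have "norm (GF p - \<kappa> *\<^sub>R p) \<le> 2 * ((2 - sqrt 3) * \<epsilon> / R) + \<kappa> * (sqrt 3 * R)"
    unfolding p
    by (rule fast_gradient_near_stationary[OF pos(3) \<kappa>L cont lower upper gap radius decay])
      (use s3 \<epsilon> R in auto)
  also have "\<kappa> * (sqrt 3 * R) = sqrt 3 / 2 * (\<epsilon> / R)"
    using R by (simp add: \<kappa>_def power2_eq_square)
  also have "2 * ((2 - sqrt 3) * \<epsilon> / R) + sqrt 3 / 2 * (\<epsilon> / R) = (4 - 3 / 2 * sqrt 3) * (\<epsilon> / R)"
    by (simp add: algebra_simps diff_divide_distrib)
  also have "\<dots> \<le> 2 * (\<epsilon> / R)"
    using s3 \<epsilon> R by (intro mult_right_mono) auto
  finally show ?thesis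
    by (simp add: GF_def grad_h p_def)
qed

section \<open>Asymptotic iteration count\<close>

text \<open>For small \<open>\<epsilon>\<close> the prefactor is at most
  \<open>M / \<epsilon>\<close> and the argument of the logarithm at most
  \<open>K / \<epsilon>\<close>, whose logarithm is at most twice
  \<open>ln (1 / \<epsilon>)\<close>.\<close>

lemma iteration_bound_asymptotics:
  fixes C1 C2 c :: real
  assumes "0 \<le> C1" "0 \<le> C2" "0 < c"
  shows "(\<lambda>\<epsilon>. real (nat \<lceil>3 / \<epsilon> * sqrt (\<epsilon>\<^sup>2 + C1) *
      ln (root 3 ((2 * \<epsilon>\<^sup>2 + 2 * C1) * (C2 + \<epsilon> / 2)) / (c * \<epsilon>))\<rceil>))
    \<in> O[at_right 0](\<lambda>\<epsilon>. 1 / \<epsilon> * ln (1 / \<epsilon>))"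
proof -
  define K where "K = root 3 ((2 + 2 * C1) * (C2 + 1)) / c"
  define M where "M = 3 * sqrt (1 + C1)"
  have K: "0 < K"
    using assms by (simp add: K_def)
  have M: "0 \<le> M"
    using assms by (simp add: M_def)
  \<comment> \<open>Below \<open>1 / K\<close> the constant \<open>ln K\<close> is dominated by
    \<open>ln (1 / \<epsilon>)\<close>; below \<open>exp (- 1)\<close> that logarithm is at least
    1.\<close>
  define \<delta> where "\<delta> = min (1 / K) (exp (- 1))"
  have bound: "norm (real (nat \<lceil>3 / \<epsilon> * sqrt (\<epsilon>\<^sup>2 + C1) *
      ln (root 3 ((2 * \<epsilon>\<^sup>2 + 2 * C1) * (C2 + \<epsilon> / 2)) / (c * \<epsilon>))\<rceil>))
      \<le> (2 * M + 1) * norm (1 / \<epsilon> * ln (1 / \<epsilon>))" if "\<epsilon> \<in> {0<..<\<delta>}" for \<epsilon>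
  proof -
    define l where "l = ln (1 / \<epsilon>)"
    define y where "y = root 3 ((2 * \<epsilon>\<^sup>2 + 2 * C1) * (C2 + \<epsilon> / 2)) / (c * \<epsilon>)"
    have \<epsilon>: "0 < \<epsilon>" "\<epsilon> < 1 / K" "\<epsilon> < exp (- 1)"
      using that by (auto simp: \<delta>_def)
    have "exp (- 1) \<le> (1 :: real)"
      by simp
    then have \<epsilon>1: "\<epsilon> \<le> 1"
      using \<epsilon> by linarith
    then have sq: "\<epsilon>\<^sup>2 \<le> 1"
      using \<epsilon> by (simp add: power_le_one)
    have "ln \<epsilon> < - 1"
      using \<epsilon> by (metis exp_less_cancel_iff exp_ln)
    then have l: "1 \<le> l"
      using \<epsilon> by (simp add: l_def ln_div)
    have "K < 1 / \<epsilon>"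
      using \<epsilon> K by (simp add: field_simps)
    then have "ln K \<le> l"
      unfolding l_def using K \<epsilon> by simp
    have "0 < (2 * \<epsilon>\<^sup>2 + 2 * C1) * (C2 + \<epsilon> / 2)"
      using assms \<epsilon> by (intro mult_pos_pos add_pos_nonneg add_nonneg_pos) auto
    then have y0: "0 < y"
      using assms \<epsilon> by (simp add: y_def)
    have "(2 * \<epsilon>\<^sup>2 + 2 * C1) * (C2 + \<epsilon> / 2) \<le> (2 + 2 * C1) * (C2 + 1)"
      using assms \<epsilon> \<epsilon>1 sq by (intro mult_mono) auto
    then have "root 3 ((2 * \<epsilon>\<^sup>2 + 2 * C1) * (C2 + \<epsilon> / 2)) \<le> root 3 ((2 + 2 * C1) * (C2 + 1))"
      by simp
    then have "y \<le> root 3 ((2 + 2 * C1) * (C2 + 1)) / (c * \<epsilon>)"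
      unfolding y_def using assms \<epsilon> by (intro divide_right_mono) auto
    also have "\<dots> = K * (1 / \<epsilon>)"
      by (simp add: K_def)
    finally have "ln y \<le> ln (K * (1 / \<epsilon>))"
      using y0 by (intro ln_mono) auto
    also have "\<dots> = ln K + l"
      unfolding l_def using K \<epsilon> by (simp add: ln_mult ln_div)
    finally have ly: "ln y \<le> 2 * l"
      using \<open>ln K \<le> l\<close> by simp
    have "3 / \<epsilon> * sqrt (\<epsilon>\<^sup>2 + C1) * ln y \<le> 3 / \<epsilon> * sqrt (\<epsilon>\<^sup>2 + C1) * (2 * l)"
      using ly \<epsilon> assms by (intro mult_left_mono) auto
    also have "\<dots> \<le> 3 / \<epsilon> * sqrt (1 + C1) * (2 * l)"
      using l \<epsilon> sq by (intro mult_right_mono mult_left_mono) auto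
    also have "\<dots> = 2 * M * (1 / \<epsilon> * l)"
      by (simp add: M_def)
    finally have x: "3 / \<epsilon> * sqrt (\<epsilon>\<^sup>2 + C1) * ln y \<le> 2 * M * (1 / \<epsilon> * l)" .
    \<comment> \<open>This absorbs the extra 1 from rounding up.\<close>
    have ge1: "1 \<le> 1 / \<epsilon> * l"
      using l \<epsilon> \<epsilon>1 by (simp add: le_divide_eq)
    moreover have ge0: "0 \<le> 2 * M * (1 / \<epsilon> * l)"
      using M l \<epsilon> by simp
    moreover have "real (nat \<lceil>3 / \<epsilon> * sqrt (\<epsilon>\<^sup>2 + C1) * ln y\<rceil>) \<le> 2 * M * (1 / \<epsilon> * l) + 1"
      using x ge0 by linarith
    ultimately have "real (nat \<lceil>3 / \<epsilon> * sqrt (\<epsilon>\<^sup>2 + C1) * ln y\<rceil>) \<le> (2 * M + 1) * (1 / \<epsilon> * l)"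
      unfolding distrib_right by linarith
    moreover have "norm (1 / \<epsilon> * l) = 1 / \<epsilon> * l"
      using ge1 unfolding real_norm_def by (intro abs_of_nonneg) linarith
    ultimately show ?thesis
      unfolding y_def[symmetric] l_def[symmetric] real_norm_def[of "real _"] by (simp only: abs_of_nat)
  qed
  have "0 < \<delta>"
    using K by (simp add: \<delta>_def)
  then show ?thesis
    by (intro bigoI[where c = "2 * M + 1"] eventually_at_rightI[of 0 \<delta>] bound)
qed


theorem mainTheorem2:
  fixes f :: "real ^ 'n \<Rightarrow> ereal"
    and g :: "real ^ 'm \<Rightarrow> ereal"
    and A :: "real ^ 'n \<Rightarrow> real ^ 'm"
    and pstar :: "real ^ 'm"
    and R :: real
  assumes "proper_fun f" "convex_fun f" "lsc_fun f" "bounded (edom f)"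
    and "proper_fun g" "convex_fun g" "lsc_fun g" "bounded (edom g)"
    and "linear A"
    and "A ` edom f \<inter> edom g \<noteq> {}"
    and "dual_solution f g A pstar"
    and "0 < R" "norm pstar \<le> R"
    and "0 < half_sq_radius f" "0 < half_sq_radius g"
  shows
    "let D\<^sub>f = half_sq_radius f;
         D\<^sub>g = half_sq_radius g;
         \<rho> = (\<lambda>\<epsilon>. \<epsilon> / (4 * D\<^sub>f));
         \<mu> = (\<lambda>\<epsilon>. \<epsilon> / (4 * D\<^sub>g));
         \<kappa> = (\<lambda>\<epsilon>. \<epsilon> / (2 * R\<^sup>2));
         p = (\<lambda>\<epsilon>. dual_iterate f g A (\<rho> \<epsilon>) (\<mu> \<epsilon>) (\<kappa> \<epsilon>))
     in (\<forall>\<epsilon>>0. \<forall>k::nat.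
           real k \<ge> 3 / \<epsilon> * sqrt (\<epsilon>\<^sup>2 + 8 * R\<^sup>2 * ((onorm A)\<^sup>2 * D\<^sub>f + D\<^sub>g)) *
             ln (root 3 ((2 * \<epsilon>\<^sup>2 + 16 * R\<^sup>2 * ((onorm A)\<^sup>2 * D\<^sub>f + D\<^sub>g)) *
                         (real_of_ereal (theta f g A 0) - real_of_ereal (theta f g A pstar) + \<epsilon> / 2)) /
                 ((2 - sqrt 3) powr (2 / 3) * \<epsilon>)) \<longrightarrow>
           norm (grad (theta_smooth f g A (\<rho> \<epsilon>) (\<mu> \<epsilon>)) (p \<epsilon> k)) \<le> 2 * \<epsilon> / R) \<and>
        (\<exists>N :: real \<Rightarrow> nat.
           (\<lambda>\<epsilon>. real (N \<epsilon>)) \<in> O[at_right 0](\<lambda>\<epsilon>. 1 / \<epsilon> * ln (1 / \<epsilon>)) \<and>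
           (\<forall>\<epsilon>>0. \<forall>k\<ge>N \<epsilon>.
             norm (grad (theta_smooth f g A (\<rho> \<epsilon>) (\<mu> \<epsilon>)) (p \<epsilon> k)) \<le> 2 * \<epsilon> / R))"
proof -
  define D where "D = (onorm A)\<^sup>2 * half_sq_radius f + half_sq_radius g"
  define c :: real where "c = (2 - sqrt 3) powr (2 / 3)"
  define C2 where "C2 = real_of_ereal (theta f g A 0) - real_of_ereal (theta f g A pstar)"
  define B where "B = (\<lambda>\<epsilon>. 3 / \<epsilon> * sqrt (\<epsilon>\<^sup>2 + 8 * R\<^sup>2 * D) *
    ln (root 3 ((2 * \<epsilon>\<^sup>2 + 16 * R\<^sup>2 * D) * (C2 + \<epsilon> / 2)) / (c * \<epsilon>)))"
  define P where "P = (\<lambda>\<epsilon> k. norm (grad (theta_smooth f g A (\<epsilon> / (4 * half_sq_radius f)) (\<epsilon> / (4 * half_sq_radius g)))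
    (dual_iterate f g A (\<epsilon> / (4 * half_sq_radius f)) (\<epsilon> / (4 * half_sq_radius g)) (\<epsilon> / (2 * R\<^sup>2)) k)) \<le> 2 * \<epsilon> / R)"
  have main: "P \<epsilon> k" if "0 < \<epsilon>" "B \<epsilon> \<le> real k" for \<epsilon> k
    unfolding P_def
    by (rule double_smoothing_gradient_bound[OF assms(1-9,11-15) that(1)])
      (use that(2) in \<open>simp only: B_def D_def c_def C2_def\<close>)
  obtain th where "\<And>p. theta f g A p = ereal (th p)" "\<And>p. th pstar \<le> th p"
    using dual_solution_minimizes_theta[OF assms(1,3,4,5,7,8,11)] by metis
  then have C2: "0 \<le> C2"
    by (simp add: C2_def)
  \<comment> \<open>A power with base 0 is 0, so \<open>0 < c\<close> rests on
    \<open>2 - sqrt 3\<close> being nonzero.\<close>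
  have "0 < sqrt 4 - sqrt (3::real)"
    by (simp only: diff_gt_0_iff_gt real_sqrt_less_iff)
  then have c: "0 < c"
    by (simp add: c_def)
  have "0 \<le> 8 * R\<^sup>2 * D"
    using assms(14,15) by (simp add: D_def)
  note asymp = iteration_bound_asymptotics[OF this C2 c]
  have "2 * (8 * R\<^sup>2 * D) = 16 * R\<^sup>2 * D"
    by simp
  from asymp[unfolded this]
  have O: "(\<lambda>\<epsilon>. real (nat \<lceil>B \<epsilon>\<rceil>)) \<in> O[at_right 0](\<lambda>\<epsilon>. 1 / \<epsilon> * ln (1 / \<epsilon>))"
    unfolding B_def .
  \<comment> \<open>The witness is the rounded-up explicit bound; \<open>nat\<close> sends a
    negative bound to 0, which still dominates it.\<close>
  have N: "P \<epsilon> k" if "0 < \<epsilon>" "nat \<lceil>B \<epsilon>\<rceil> \<le> k" for \<epsilon> k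
  proof (rule main[OF that(1)])
    show "B \<epsilon> \<le> real k"
      using that(2) by linarith
  qed
  show ?thesis
    unfolding Let_def
    by (intro conjI exI[of _ "\<lambda>\<epsilon>. nat \<lceil>B \<epsilon>\<rceil>"] allI impI O N[unfolded P_def]
        main[unfolded P_def B_def c_def C2_def D_def])
qed

end
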